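(* For every $n\geq 1$, the number of maximal elements of the poset $(\mathscr{D}_n,\leq)$ is the Motzkin number $m_{n-1}$, where the Motzkin numbers $(m_j)_{j\geq 0}=1,1,2,4,9,\dots$ are the coefficients of the power series $M=\sum_{j\ge 0}m_jt^j$ determined by $M=1+tM+t^2M^2$.
   Context: A Dyck path of size $n\geq 0$ is a word of length $2n$ in the letters $0,1$ with $n$ letters $1$ and $n$ letters $0$ such that every prefix contains at least as many $1$'s as $0$'s (the height after a prefix is its number of $1$'s minus its number of $0$'s). Let $\mathscr{D}_n$ be the set of Dyck paths of size $n$. A subpath of a Dyck path $w$ is a non-empty sequence $x$ of consecutive letters of $w$ that starts and ends at the same height and stays strictly above that height in between. A subpath $x$ is movable in $w$ if it is immediately preceded in $w$ by the letter $0$ and either $x$ ends at the last letter of $w$ or $x$ is immediately followed in $w$ by the letter $1$. For a movable subpath $x$, let $N=N(w,x)\geq 1$ be the number of consecutive letters $0$ just before $x$, so $w=a\,0^{N}\,x\,b$ where $a$ does not end with $0$; for $1\leq i\leq N$ let $M(w,x,i)=a\,0^{N-i}\,x\,0^{i}\,b\in\mathscr{D}_n$. Let $\Gamma_n$ be the directed graph on $\mathscr{D}_n$ with edges $w\to M(w,x,i)$ for all movable $x$ in $w$ and all $1\leq i\leq N(w,x)$. The dexter order is: $u\leq v$ if and only if there is a directed path (possibly of length $0$) from $u$ to $v$ in $\Gamma_n$. This is a partial order whose cover relations are exactly the edges of $\Gamma_n$. *)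

theory Defs
  imports Main "HOL-Computational_Algebra.Formal_Power_Series"
begin

datatype letter = Zero | One

definition height :: "letter list \<Rightarrow> int" where
  "height w = int (count_list w One) - int (count_list w Zero)"

definition dyck_paths :: "nat \<Rightarrow> letter list set" where
  "dyck_paths n = {w. length w = 2 * n \<and> count_list w One = n \<and> count_list w Zero = n \<and>
     (\<forall>k \<le> length w. count_list (take k w) Zero \<le> count_list (take k w) One)}"

text \<open>A subpath is an occurrence of a factor, not just a word. The occurrence of \<open>x\<close> in
  \<open>p @ x @ b\<close> right after the prefix \<open>p\<close> is represented by the triple \<open>p\<close>, \<open>x\<close>, \<open>b\<close>.\<close>

definition is_subpath :: "letter list \<Rightarrow> letter list \<Rightarrow> letter list \<Rightarrow> bool" where
  "is_subpath p x b \<longleftrightarrow> x \<noteq> [] \<and> height (p @ x) = height p \<and>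
     (\<forall>k. 0 < k \<and> k < length x \<longrightarrow> height p < height (p @ take k x))"

definition movable :: "letter list \<Rightarrow> letter list \<Rightarrow> letter list \<Rightarrow> bool" where
  "movable p x b \<longleftrightarrow> is_subpath p x b \<and> p \<noteq> [] \<and> last p = Zero \<and> (b = [] \<or> hd b = One)"

text \<open>The condition on \<open>a\<close> forces \<open>N\<close> to be the number of all consecutive letters \<open>Zero\<close>
  just before \<open>x\<close>.\<close>

definition dexter_graph :: "nat \<Rightarrow> (letter list \<times> letter list) set" where
  "dexter_graph n =
     {(w, a @ replicate (N - i) Zero @ x @ replicate i Zero @ b) | w a N x b i.
        w \<in> dyck_paths n \<and> w = a @ replicate N Zero @ x @ b \<and>
        (a = [] \<or> last a \<noteq> Zero) \<and>
        movable (a @ replicate N Zero) x b \<and> 1 \<le> i \<and> i \<le> N}"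

definition dexter_le :: "nat \<Rightarrow> letter list \<Rightarrow> letter list \<Rightarrow> bool" where
  "dexter_le n u v \<longleftrightarrow> u \<in> dyck_paths n \<and> v \<in> dyck_paths n \<and> (u, v) \<in> (dexter_graph n)\<^sup>*"

definition dexter_maximal :: "nat \<Rightarrow> letter list set" where
  "dexter_maximal n = {u \<in> dyck_paths n. \<forall>v \<in> dyck_paths n. dexter_le n u v \<longrightarrow> v = u}"

definition motzkin_fps :: "nat fps" where
  "motzkin_fps = (THE M. M = 1 + fps_X * M + fps_X\<^sup>2 * M\<^sup>2)"

definition motzkin :: "nat \<Rightarrow> nat" where
  "motzkin j = fps_nth motzkin_fps j"

fun motz_rec :: "nat \<Rightarrow> nat" where
  "motz_rec 0 = 1"
| "motz_rec (Suc 0) = 1"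
| "motz_rec (Suc (Suc n)) = motz_rec (Suc n) + (\<Sum>i\<le>n. motz_rec i * motz_rec (n - i))"

lemma motzkin_equation_iff:
  fixes M :: "nat fps"
  shows "M = 1 + fps_X * M + fps_X\<^sup>2 * M\<^sup>2 \<longleftrightarrow>
    fps_nth M 0 = 1 \<and> fps_nth M 1 = fps_nth M 0 \<and>
    (\<forall>n. fps_nth M (Suc (Suc n)) = fps_nth M (Suc n) + (\<Sum>i\<le>n. fps_nth M i * fps_nth M (n - i)))"
    (is "_ \<longleftrightarrow> ?R")
proof -
  let ?F = "1 + fps_X * M + fps_X\<^sup>2 * M\<^sup>2"
  have c0: "fps_nth ?F 0 = 1" by (simp add: fps_X_power_mult_nth)
  have c1: "fps_nth ?F 1 = fps_nth M 0" by (simp add: fps_X_power_mult_nth)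
  have c2: "fps_nth ?F (Suc (Suc n)) =
      fps_nth M (Suc n) + (\<Sum>i\<le>n. fps_nth M i * fps_nth M (n - i))" for n
  proof -
    have "fps_nth (M\<^sup>2) n = (\<Sum>i\<le>n. fps_nth M i * fps_nth M (n - i))"
      unfolding power2_eq_square by (simp add: fps_mult_nth atLeast0AtMost)
    then show ?thesis by (simp add: fps_X_power_mult_nth)
  qed
  have "M = ?F \<longleftrightarrow> (\<forall>n. fps_nth M n = fps_nth ?F n)" by (simp add: fps_eq_iff)
  also have "\<dots> \<longleftrightarrow> fps_nth M 0 = fps_nth ?F 0 \<and> fps_nth M 1 = fps_nth ?F 1 \<and>
      (\<forall>n. fps_nth M (Suc (Suc n)) = fps_nth ?F (Suc (Suc n)))"
    by (metis One_nat_def not0_implies_Suc)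
  finally show ?thesis unfolding c0 c1 c2 .
qed

lemma motzkin_fps_ex1: "\<exists>!M :: nat fps. M = 1 + fps_X * M + fps_X\<^sup>2 * M\<^sup>2"
proof (rule ex1I)
  show "Abs_fps motz_rec = 1 + fps_X * Abs_fps motz_rec + fps_X\<^sup>2 * (Abs_fps motz_rec)\<^sup>2"
    unfolding motzkin_equation_iff by simp
next
  fix M :: "nat fps"
  assume "M = 1 + fps_X * M + fps_X\<^sup>2 * M\<^sup>2"
  then have R: "fps_nth M 0 = 1" "fps_nth M 1 = fps_nth M 0"
    "\<And>n. fps_nth M (Suc (Suc n)) = fps_nth M (Suc n) + (\<Sum>i\<le>n. fps_nth M i * fps_nth M (n - i))"
    unfolding motzkin_equation_iff by auto
  have "fps_nth M n = motz_rec n" for n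
  proof (induction n rule: motz_rec.induct)
    case (3 n)
    have "(\<Sum>i\<le>n. fps_nth M i * fps_nth M (n - i)) = (\<Sum>i\<le>n. motz_rec i * motz_rec (n - i))"
      using 3 by (intro sum.cong) auto
    with 3 R(3)[of n] show ?case by simp
  qed (use R in simp_all)
  then show "M = Abs_fps motz_rec" by (simp add: fps_eq_iff)
qed

lemma motzkin_fps_equation:
  "motzkin_fps = 1 + fps_X * motzkin_fps + fps_X\<^sup>2 * motzkin_fps\<^sup>2"
  unfolding motzkin_fps_def by (rule theI'[OF motzkin_fps_ex1])

end

theory Submission imports Defs begin

text \<open>A path is maximal iff it has no movable subpath, that is, iff every arch preceded by
  the letter \<open>0\<close> is followed by the letter \<open>0\<close>. At height zero nothing can follow an arch except
  another arch, so a non-empty maximal path is a single arch \<open>1 u 0\<close>. Inside, \<open>u\<close> has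
  at most two arches: the second one is preceded by \<open>0\<close>, and the
  letter after it is \<open>0\<close> only if it closes the surrounding arch. The maximal paths of positive size
  are thus \<open>10\<close>, \<open>1 B 0\<close> and \<open>1 B B' 0\<close> with \<open>B\<close>, \<open>B'\<close> maximal of positive size, which is the
  recursion of the Motzkin numbers.\<close>

section \<open>Prefix heights and Dyck words\<close>

lemma height_simps [simp]:
  "height [] = 0"
  "height (One # w) = height w + 1"
  "height (Zero # w) = height w - 1"
  "height (u @ v) = height u + height v"
  by (simp_all add: height_def)

text \<open>The starting height is an argument so that the condition splits over concatenation
  (\<open>stays_append\<close>) and survives a lift to a higher level
  (\<open>stays_mono\<close>).\<close>

fun stays :: "int \<Rightarrow> letter list \<Rightarrow> bool" where
  "stays h [] \<longleftrightarrow> 0 \<le> h"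
| "stays h (l # w) \<longleftrightarrow> 0 \<le> h \<and> stays (h + height [l]) w"

lemma stays_height: "stays h w \<Longrightarrow> 0 \<le> h + height w"
proof (induction w arbitrary: h)
  case (Cons l w)
  then show ?case by (cases l) fastforce+
qed simp

lemma stays_nonneg: "stays h w \<Longrightarrow> 0 \<le> h"
  by (cases w) auto

lemma stays_append [simp]: "stays h (u @ v) \<longleftrightarrow> stays h u \<and> stays (h + height u) v"
proof (induction u arbitrary: h)
  case Nil
  then show ?case using stays_nonneg by auto
next
  case (Cons l u)
  have "height (l # u) = height [l] + height u" by (cases l) auto
  with Cons show ?case by (simp add: add.assoc)
qed

lemma stays_mono: "stays h w \<Longrightarrow> h \<le> h' \<Longrightarrow> stays h' w"
proof (induction w arbitrary: h h')
  case (Cons l w)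
  from Cons.IH[of "h + height [l]" "h' + height [l]"] Cons.prems show ?case by auto
qed simp

text \<open>Connects the recursive form with the conditions on prefixes in \<open>dyck_paths\<close>
  and \<open>is_subpath\<close>. The direction from prefixes goes by induction from the right, since
  a letter at the end adds just one prefix.\<close>

lemma stays_iff_take: "stays h w \<longleftrightarrow> (\<forall>k\<le>length w. 0 \<le> h + height (take k w))"
proof
  assume "stays h w"
  then have "stays h (take k w @ drop k w)" for k by simp
  then show "\<forall>k\<le>length w. 0 \<le> h + height (take k w)"
    unfolding stays_append using stays_height by blast
next
  show "\<forall>k\<le>length w. 0 \<le> h + height (take k w) \<Longrightarrow> stays h w"
  proof (induction w rule: rev_induct)
    case (snoc l w)
    have "0 \<le> h + height (take k w)" if "k \<le> length w" for k
      using snoc.prems[rule_format, of k] that by simp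
    moreover have "0 \<le> h + height (w @ [l])"
      using snoc.prems[rule_format, of "length (w @ [l])"] by simp
    ultimately show ?case using snoc.IH stays_height by simp
  qed simp
qed

text \<open>These are the Dyck words of any size, the empty one included.\<close>

definition balanced :: "letter list \<Rightarrow> bool" where
  "balanced w \<longleftrightarrow> stays 0 w \<and> height w = 0"

lemma balanced_append: "balanced u \<Longrightarrow> balanced (u @ v) \<longleftrightarrow> balanced v"
  by (auto simp: balanced_def)

lemma count_list_letters: "count_list w One + count_list w Zero = length w"
proof (induction w)
  case (Cons l w)
  then show ?case by (cases l) auto
qed simp

lemma dyck_paths_iff: "w \<in> dyck_paths n \<longleftrightarrow> balanced w \<and> length w = 2 * n"
  using count_list_letters[of w]
  by (auto simp: dyck_paths_def balanced_def stays_iff_take height_def)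

section \<open>Arches, the prime Dyck words\<close>

definition arches :: "letter list set" where
  "arches = {One # u @ [Zero] | u. balanced u}"

lemma arches_nonempty: "x \<in> arches \<Longrightarrow> x \<noteq> []"
  by (auto simp: arches_def)

lemma arch_balanced: "x \<in> arches \<Longrightarrow> balanced x"
  using stays_mono[of 0 _ 1] by (auto simp: arches_def balanced_def)

text \<open>Without its leading \<open>One\<close>, \<open>e\<close> is a prefix of the inner Dyck
  word and so has height at least 0; the leading \<open>One\<close> adds 1.\<close>

lemma arch_proper_prefix:
  assumes "x \<in> arches" "x = e @ f" "e \<noteq> []" "f \<noteq> []"
  shows "0 < height e"
proof -
  obtain u where u: "balanced u" "x = One # u @ [Zero]"
    using assms by (auto simp: arches_def)
  obtain e' where e: "e = One # e'" using assms u by (cases e) auto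
  obtain f' l where f: "f = f' @ [l]" using assms by (cases f rule: rev_cases) auto
  have "u = e' @ f'" using assms u e f by auto
  then have "stays 0 e'" using u by (auto simp: balanced_def)
  then show ?thesis using e stays_height by fastforce
qed

text \<open>Heights relative to the end of \<open>p\<close> do not depend on \<open>p\<close>, so
  the word \<open>x\<close> alone decides. Conversely, height 0 at the end and positive heights in
  between force a first \<open>One\<close> and a last \<open>Zero\<close>; without that
  \<open>One\<close>, positive heights become nonnegative ones.\<close>

lemma is_subpath_iff_arch: "is_subpath p x b \<longleftrightarrow> x \<in> arches"
proof
  assume x: "x \<in> arches"
  have "0 < height (take k x)" if "0 < k" "k < length x" for k
    by (rule arch_proper_prefix[OF x, of _ "drop k x"]) (use that in auto)
  then show "is_subpath p x b"
    using arch_balanced[OF x] arches_nonempty[OF x] by (auto simp: is_subpath_def balanced_def)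
next
  assume "is_subpath p x b"
  then have x: "x \<noteq> []" "height x = 0" "\<And>k. 0 < k \<Longrightarrow> k < length x \<Longrightarrow> 0 < height (take k x)"
    by (auto simp: is_subpath_def)
  obtain l y where ly: "x = l # y" using x by (cases x) auto
  have "y \<noteq> []" using x ly by (cases l) auto
  then obtain u m where y: "y = u @ [m]" by (cases y rule: rev_cases) auto
  have l: "l = One" using x(3)[of 1] ly y by (cases l) auto
  have t: "take (Suc k) x = One # take k u" if "k \<le> length u" for k
    using that ly y l by simp
  have h: "0 \<le> height (take k u)" if "k \<le> length u" for k
    using x(3)[of "Suc k"] that ly y t by fastforce
  have "m = Zero" using h[of "length u"] x ly y l by (cases m) auto
  moreover have "balanced u"
    using h x ly y l \<open>m = Zero\<close> by (auto simp: balanced_def stays_iff_take)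
  ultimately show "x \<in> arches" using ly y l by (auto simp: arches_def)
qed

text \<open>The split is at the first descent to height -1. If \<open>w\<close> starts with
  \<open>One\<close>, the induction hypothesis is used twice: on the tail, to close this
  \<open>One\<close> to an arch, and on what follows that arch, whose height is still
  negative.\<close>

lemma balanced_before_Zero:
  "height w < 0 \<Longrightarrow> \<exists>u v. w = u @ Zero # v \<and> balanced u"
proof (induction w rule: length_induct)
  case (1 w)
  then obtain l w' where w: "w = l # w'" by (cases w) auto
  show ?case
  proof (cases l)
    case Zero
    then show ?thesis using w by (intro exI[of _ "[]"] exI[of _ w']) (auto simp: balanced_def)
  next
    case One
    then obtain u1 v1 where 1: "w' = u1 @ Zero # v1" "balanced u1"
      using 1 w by fastforce
    then have "height v1 < 0" "length v1 < length w"
      using 1 \<open>height w < 0\<close> w One by (auto simp: balanced_def)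
    then obtain u2 v2 where 2: "v1 = u2 @ Zero # v2" "balanced u2"
      using "1.IH" by blast
    have "One # u1 @ [Zero] \<in> arches" using 1 by (auto simp: arches_def)
    then have "balanced ((One # u1 @ [Zero]) @ u2)"
      using 2 arch_balanced balanced_append by blast
    then show ?thesis
      using w One 1 2 by (intro exI[of _ "(One # u1 @ [Zero]) @ u2"] exI[of _ v2]) auto
  qed
qed

text \<open>Removing the initial \<open>One\<close> leaves height -1, so
  \<open>balanced_before_Zero\<close> finds the \<open>Zero\<close> that matches it.\<close>

lemma balanced_first_arch:
  assumes "balanced w" "w \<noteq> []"
  shows "\<exists>x v. w = x @ v \<and> x \<in> arches \<and> balanced v"
proof -
  obtain l w' where w: "w = l # w'" using assms by (cases w) auto
  have l: "l = One" using assms w by (cases l) (auto simp: balanced_def dest: stays_nonneg)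
  have "height w' < 0" using assms w l by (auto simp: balanced_def)
  then obtain u v where u: "w' = u @ Zero # v" "balanced u" using balanced_before_Zero by blast
  have x: "One # u @ [Zero] \<in> arches" using u by (auto simp: arches_def)
  have eq: "w = (One # u @ [Zero]) @ v" using w l u by simp
  with assms(1) have "balanced v" using balanced_append[OF arch_balanced[OF x]] by simp
  with eq x show ?thesis by blast
qed

text \<open>One of the two arches is a prefix of the other. A proper non-empty prefix of an arch has
  positive height, while an arch has height 0.\<close>

lemma arch_prefix_unique:
  assumes "x \<in> arches" "y \<in> arches" "x @ v = y @ w"
  shows "x = y"
proof -
  have *: "e = []" if "x' \<in> arches" "y' \<in> arches" "x' = y' @ e" for x' y' e
  proof (rule ccontr)
    assume "e \<noteq> []"
    then have "0 < height y'"
      using arch_proper_prefix[OF that(1,3)] arches_nonempty[OF that(2)] by blast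
    then show False using arch_balanced[OF that(2)] by (simp add: balanced_def)
  qed
  from assms(3) consider e where "x = y @ e" | e where "y = x @ e"
    by (auto simp: append_eq_append_conv2)
  then show ?thesis
  proof cases
    case (1 e)
    then show ?thesis using *[OF assms(1,2) 1] by simp
  next
    case (2 e)
    then show ?thesis using *[OF assms(2,1) 2] by simp
  qed
qed

text \<open>If \<open>x\<close> ended \<open>w\<close>, the proper prefix \<open>q\<close> would
  have height 0.\<close>

lemma arch_inside_arch:
  assumes "w \<in> arches" "x \<in> arches" "w = q @ x @ b" "q \<noteq> []"
  shows "b \<noteq> []"
proof
  assume "b = []"
  then have "0 < height q"
    using arch_proper_prefix[of w q x] assms arches_nonempty by auto
  then show False
    using assms \<open>b = []\<close> arch_balanced[OF assms(1)] arch_balanced[OF assms(2)]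
    by (simp add: balanced_def)
qed

text \<open>An arch cannot straddle the boundary: its part \<open>e\<close> inside \<open>s\<close>
  would have positive height, and the prefix \<open>q\<close> of \<open>s\<close> has height at
  least 0, so \<open>s\<close> could not end at height 0.\<close>

lemma arch_in_append:
  assumes s: "balanced s" and x: "x \<in> arches" and eq: "s @ t = q @ x @ b"
  shows "(\<exists>c. s = q @ x @ c \<and> b = c @ t) \<or> (\<exists>c. q = s @ c \<and> t = c @ x @ b)"
proof -
  consider c where "q = s @ c" "t = c @ x @ b" | e where "s = q @ e" "e @ t = x @ b"
    using eq by (auto simp: append_eq_append_conv2)
  then show ?thesis
  proof cases
    case (2 e)
    then consider c where "e = x @ c" "b = c @ t" | f where "x = e @ f" "t = f @ b"
      by (auto simp: append_eq_append_conv2)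
    then show ?thesis
    proof cases
      case (2 f)
      have "e = [] \<or> f = []"
      proof (rule ccontr)
        assume "\<not> ?thesis"
        then have "0 < height e" using arch_proper_prefix[OF x 2(1)] by simp
        moreover have "0 \<le> height q"
          using s \<open>s = q @ e\<close> stays_height[of 0 q] by (simp add: balanced_def)
        ultimately show False using s \<open>s = q @ e\<close> by (simp add: balanced_def)
      qed
      then show ?thesis using \<open>s = q @ e\<close> 2 by auto
    qed (use 2 in auto)
  qed auto
qed

section \<open>Words without movable subpaths\<close>

definition settled :: "letter list \<Rightarrow> bool" where
  "settled w \<longleftrightarrow> (\<forall>q x b. w = q @ x @ b \<longrightarrow> x \<in> arches \<longrightarrow>
     q = [] \<or> last q = One \<or> (b \<noteq> [] \<and> hd b = Zero))"

lemma settledD: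
  assumes "settled w" "w = q @ x @ b" "x \<in> arches"
  shows "q = [] \<or> last q = One \<or> (b \<noteq> [] \<and> hd b = Zero)"
  using assms unfolding settled_def by blast

lemma not_settled_iff: "\<not> settled w \<longleftrightarrow> (\<exists>p x b. w = p @ x @ b \<and> movable p x b)"
proof -
  have "l \<noteq> One \<longleftrightarrow> l = Zero" "l \<noteq> Zero \<longleftrightarrow> l = One" for l
    by (cases l; simp)+
  then show ?thesis unfolding settled_def movable_def is_subpath_iff_arch by blast
qed

text \<open>An arch that does not start \<open>w\<close> does not end it either, by
  \<open>arch_inside_arch\<close>, so its neighbours in the larger word are its neighbours in
  \<open>w\<close>.\<close>

lemma settled_arch_factor:
  assumes "settled (l @ w @ r)" "w \<in> arches"
  shows "settled w"
  unfolding settled_def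
proof (intro allI impI)
  fix q x b
  assume w: "w = q @ x @ b" and x: "x \<in> arches"
  show "q = [] \<or> last q = One \<or> (b \<noteq> [] \<and> hd b = Zero)"
  proof (cases "q = []")
    case False
    then have "b \<noteq> []" using arch_inside_arch[OF assms(2) x w] by simp
    have "l @ w @ r = (l @ q) @ x @ (b @ r)" using w by simp
    from settledD[OF assms(1) this x] show ?thesis using False \<open>b \<noteq> []\<close> by auto
  qed simp
qed

text \<open>The condition \<open>ok\<close> is weaker than \<open>settled w\<close>: it exempts an
  arch that ends \<open>w\<close>, because the new final \<open>Zero\<close> will follow it. This
  leaves room for a second arch in \<open>settled_binary\<close>.\<close>

lemma settled_wrap:
  assumes "balanced w"
    and ok: "\<And>q x b. w = q @ x @ b \<Longrightarrow> x \<in> arches \<Longrightarrow>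
      q = [] \<or> last q = One \<or> b = [] \<or> hd b = Zero"
  shows "settled (One # w @ [Zero])"
  unfolding settled_def
proof (intro allI impI)
  fix q x b
  assume eq: "One # w @ [Zero] = q @ x @ b" and x: "x \<in> arches"
  show "q = [] \<or> last q = One \<or> (b \<noteq> [] \<and> hd b = Zero)"
  proof (cases q)
    case (Cons l q')
    then have q: "q = One # q'" and eq': "w @ [Zero] = q' @ x @ b" using eq by auto
    from arch_in_append[OF assms(1) x eq']
    consider c where "w = q' @ x @ c" "b = c @ [Zero]" | c where "[Zero] = c @ x @ b" by auto
    then show ?thesis
    proof cases
      case (1 c)
      then show ?thesis using ok[OF 1(1) x] q by (cases c) auto
    next
      case (2 c)
      then show ?thesis using x by (auto simp: arches_def Cons_eq_append_conv)
    qed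
  qed simp
qed

lemma settled_leaf: "settled [One, Zero]"
proof -
  have "settled (One # [] @ [Zero])"
    by (rule settled_wrap) (simp_all add: balanced_def)
  then show ?thesis by simp
qed

lemma settled_unary:
  assumes "s \<in> arches" "settled s"
  shows "settled (One # s @ [Zero])"
proof (rule settled_wrap[OF arch_balanced[OF assms(1)]])
  show "q = [] \<or> last q = One \<or> b = [] \<or> hd b = Zero"
    if "s = q @ x @ b" "x \<in> arches" for q x b
    using settledD[OF assms(2) that] by blast
qed

text \<open>The critical occurrence is \<open>t\<close> itself, now preceded by the last
  \<open>Zero\<close> of \<open>s\<close>. It ends \<open>s @ t\<close>, which
  \<open>settled_wrap\<close> permits.\<close>

lemma settled_binary:
  assumes "s \<in> arches" "t \<in> arches" "settled s" "settled t"
  shows "settled (One # (s @ t) @ [Zero])"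
proof (rule settled_wrap)
  show "balanced (s @ t)" using assms arch_balanced balanced_append by blast
next
  fix q x b
  assume eq: "s @ t = q @ x @ b" and x: "x \<in> arches"
  from arch_in_append[OF arch_balanced[OF assms(1)] x eq]
  consider c where "s = q @ x @ c" "b = c @ t" | c where "q = s @ c" "t = c @ x @ b" by auto
  then show "q = [] \<or> last q = One \<or> b = [] \<or> hd b = Zero"
  proof cases
    case (1 c)
    then have "q = [] \<or> last q = One \<or> (c \<noteq> [] \<and> hd c = Zero)"
      using settledD[OF assms(3)] x by blast
    then show ?thesis using 1 by auto
  next
    case (2 c)
    show ?thesis
    proof (cases "c = []")
      case True
      then have "t = x" using arch_prefix_unique[OF assms(2) x, of "[]" b] 2 by simp
      then show ?thesis using 2 True by simp
    next
      case False
      then have "last c = One \<or> (b \<noteq> [] \<and> hd b = Zero)"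
        using settledD[OF assms(4) 2(2) x] by blast
      then show ?thesis using 2 False by auto
    qed
  qed
qed

lemma hd_arch_append: "x \<in> arches \<Longrightarrow> hd (x @ v) = One"
  by (auto simp: arches_def)

lemma last_append_arch: "x \<in> arches \<Longrightarrow> last (v @ x) = Zero"
  by (auto simp: arches_def)

text \<open>A second arch would be preceded by the last \<open>Zero\<close> of the first, hence
  followed by \<open>Zero\<close>; but what follows it is a Dyck word, which cannot start with
  \<open>Zero\<close>.\<close>

lemma settled_balanced_arch:
  assumes "balanced w" "w \<noteq> []" "settled w"
  shows "w \<in> arches"
proof -
  obtain x v where x: "w = x @ v" "x \<in> arches" "balanced v"
    using balanced_first_arch[OF assms(1,2)] by blast
  have "v = []"
  proof (rule ccontr)
    assume "v \<noteq> []"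
    then obtain y v' where y: "v = y @ v'" "y \<in> arches" "balanced v'"
      using balanced_first_arch[OF x(3)] by blast
    have "v' \<noteq> [] \<and> hd v' = Zero"
      using settledD[OF assms(3), of x y v'] x y arches_nonempty last_append_arch[of x "[]"]
      by auto
    then obtain z v'' where "v' = z @ v''" "z \<in> arches"
      using balanced_first_arch[OF y(3)] by blast
    with \<open>v' \<noteq> [] \<and> hd v' = Zero\<close> show False using hd_arch_append by simp
  qed
  then show ?thesis using x by simp
qed

text \<open>A second arch \<open>t\<close> inside \<open>w\<close> follows the last
  \<open>Zero\<close> of \<open>s\<close>, so the letter after \<open>t\<close> is
  \<open>Zero\<close>. A third arch would put \<open>One\<close> there, so only the final
  \<open>Zero\<close> of \<open>w\<close> remains.\<close>

lemma settled_arch_cases: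
  assumes "w \<in> arches" "settled w"
  obtains "w = [One, Zero]"
  | s where "w = One # s @ [Zero]" "s \<in> arches" "settled s"
  | s t where "w = One # (s @ t) @ [Zero]" "s \<in> arches" "t \<in> arches" "settled s" "settled t"
proof -
  obtain u where u: "w = One # u @ [Zero]" "balanced u" using assms by (auto simp: arches_def)
  show ?thesis
  proof (cases "u = []")
    case True
    then show ?thesis using that(1) u by simp
  next
    case False
    then obtain s v where s: "u = s @ v" "s \<in> arches" "balanced v"
      using balanced_first_arch[OF u(2)] by blast
    have "w = [One] @ s @ (v @ [Zero])" using u s by simp
    with assms(2) s(2) have "settled s" using settled_arch_factor by blast
    show ?thesis
    proof (cases "v = []")
      case True
      then show ?thesis using that(2) u s \<open>settled s\<close> by simp
    next
      case False
      then obtain t v' where t: "v = t @ v'" "t \<in> arches" "balanced v'"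
        using balanced_first_arch[OF s(3)] by blast
      have w: "w = (One # s) @ t @ (v' @ [Zero])" using u s t by simp
      with assms(2) t(2) have "settled t" using settled_arch_factor by blast
      have "last (One # s) = Zero" using last_append_arch[OF s(2), of "[One]"] by simp
      then have "hd (v' @ [Zero]) = Zero"
        using settledD[OF assms(2) w t(2)] by simp
      moreover have "hd v' = One" if "v' \<noteq> []"
        using balanced_first_arch[OF t(3) that] hd_arch_append by blast
      ultimately have "v' = []" by (cases v') auto
      then show ?thesis using that(3) u s t \<open>settled s\<close> \<open>settled t\<close> by simp
    qed
  qed
qed

section \<open>The Motzkin recursion\<close>

definition settled_arches :: "nat \<Rightarrow> letter list set" where
  "settled_arches n = {w \<in> arches. settled w \<and> length w = 2 * n}"

lemma arch_length:
  assumes "x \<in> arches"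
  shows "\<exists>k. length x = 2 * Suc k"
proof -
  have "even (length x)"
    using arch_balanced[OF assms] count_list_letters[of x, symmetric]
    by (simp add: balanced_def height_def)
  moreover have "2 \<le> length x" using assms by (auto simp: arches_def)
  ultimately show ?thesis by (intro exI[of _ "length x div 2 - 1"]) auto
qed

lemma wrap_in_arches [simp]: "One # w @ [Zero] \<in> arches \<longleftrightarrow> balanced w"
  by (auto simp: arches_def)

lemma settled_arches_1: "settled_arches (Suc 0) = {[One, Zero]}"
proof
  have "[One, Zero] \<in> arches" using wrap_in_arches[of "[]"] by (simp add: balanced_def)
  then show "{[One, Zero]} \<subseteq> settled_arches (Suc 0)"
    using settled_leaf by (simp add: settled_arches_def)
  show "settled_arches (Suc 0) \<subseteq> {[One, Zero]}"
  proof
    fix w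
    assume "w \<in> settled_arches (Suc 0)"
    then show "w \<in> {[One, Zero]}"
      by (auto simp: settled_arches_def arches_def length_Suc_conv numeral_2_eq_2)
  qed
qed

text \<open>The outer pair of letters contributes 1 to the size, and 1 + (i + 1) + (n - i) = n + 2.
  The bound i < n keeps the size of \<open>t\<close> positive.\<close>

lemma settled_arches_rec:
  "settled_arches (Suc (Suc n)) =
    (\<lambda>s. One # s @ [Zero]) ` settled_arches (Suc n) \<union>
    (\<Union>i<n. (\<lambda>(s, t). One # (s @ t) @ [Zero]) `
      (settled_arches (Suc i) \<times> settled_arches (n - i)))"
  (is "?L = ?U \<union> ?B")
proof
  show "?L \<subseteq> ?U \<union> ?B"
  proof
    fix w
    assume "w \<in> ?L"
    then have w: "w \<in> arches" "settled w" and len: "length w = 2 * Suc (Suc n)"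
      by (auto simp: settled_arches_def)
    show "w \<in> ?U \<union> ?B"
      using w
    proof (cases rule: settled_arch_cases)
      case 1
      then show ?thesis using len by simp
    next
      case (2 s)
      then show ?thesis using len by (auto simp: settled_arches_def)
    next
      case (3 s t)
      obtain i where i: "length s = 2 * Suc i" using arch_length[OF 3(2)] by blast
      obtain j where j: "length t = 2 * Suc j" using arch_length[OF 3(3)] by blast
      have ij: "i < n" "n - i = Suc j" using len 3 i j by auto
      then have "(s, t) \<in> settled_arches (Suc i) \<times> settled_arches (n - i)"
        using 3 i j by (auto simp: settled_arches_def)
      then have "w \<in> (\<lambda>(s, t). One # (s @ t) @ [Zero]) `
          (settled_arches (Suc i) \<times> settled_arches (n - i))"
        unfolding 3(1) by (rule rev_image_eqI) simp
      then show ?thesis using \<open>i < n\<close> by blast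
    qed
  qed
next
  have "?U \<subseteq> ?L"
    using settled_unary arch_balanced by (auto simp: settled_arches_def)
  moreover have "?B \<subseteq> ?L"
  proof clarify
    fix i s t
    assume "i < n" and s: "s \<in> settled_arches (Suc i)" and t: "t \<in> settled_arches (n - i)"
    have "balanced (s @ t)"
      using s t arch_balanced balanced_append by (auto simp: settled_arches_def)
    moreover have "settled (One # (s @ t) @ [Zero])"
      using s t by (intro settled_binary) (auto simp: settled_arches_def)
    moreover have "length (One # (s @ t) @ [Zero]) = 2 * Suc (Suc n)"
      using s t \<open>i < n\<close> by (auto simp: settled_arches_def)
    ultimately show "One # (s @ t) @ [Zero] \<in> ?L"
      unfolding settled_arches_def using wrap_in_arches by blast
  qed
  ultimately show "?U \<union> ?B \<subseteq> ?L" by (rule Un_least)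
qed

lemma finite_settled_arches: "finite (settled_arches n)"
proof -
  have "l \<in> {Zero, One}" for l by (cases l) auto
  then have "settled_arches n \<subseteq> {w. set w \<subseteq> {Zero, One} \<and> length w = 2 * n}"
    unfolding settled_arches_def by blast
  then show ?thesis
    by (rule finite_subset) (rule finite_lists_length_eq, simp)
qed

lemma card_settled_arches_rec:
  "card (settled_arches (Suc (Suc n))) = card (settled_arches (Suc n)) +
    (\<Sum>i<n. card (settled_arches (Suc i)) * card (settled_arches (n - i)))"
proof -
  define U where "U = (\<lambda>s. One # s @ [Zero]) ` settled_arches (Suc n)"
  define B where "B i = (\<lambda>(s, t). One # (s @ t) @ [Zero]) `
      (settled_arches (Suc i) \<times> settled_arches (n - i))" for i
  \<comment> \<open>The sizes \<open>i\<close> and \<open>j\<close> may differ, so this serves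
    injectivity within one \<open>B i\<close> as well as disjointness of different ones.\<close>
  have unique: "s = s'" if "s @ t = s' @ t'" "s \<in> settled_arches i" "s' \<in> settled_arches j"
    for s t s' t' i j
    using arch_prefix_unique[of s s' t t'] that by (simp add: settled_arches_def)
  have "card U = card (settled_arches (Suc n))"
    unfolding U_def by (intro card_image inj_onI) simp
  moreover have "card (B i) = card (settled_arches (Suc i)) * card (settled_arches (n - i))" for i
  proof -
    have "inj_on (\<lambda>(s, t). One # (s @ t) @ [Zero])
        (settled_arches (Suc i) \<times> settled_arches (n - i))"
    proof (rule inj_onI)
      fix y z
      assume yz: "y \<in> settled_arches (Suc i) \<times> settled_arches (n - i)"
          "z \<in> settled_arches (Suc i) \<times> settled_arches (n - i)"
        and eq: "(\<lambda>(s, t). One # (s @ t) @ [Zero]) y = (\<lambda>(s, t). One # (s @ t) @ [Zero]) z"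
      obtain s t s' t' where y: "y = (s, t)" and z: "z = (s', t')" by (cases y, cases z)
      have app: "s @ t = s' @ t'" using eq y z by simp
      with yz y z have "s = s'" by (intro unique[of s t s' t']) auto
      with app y z show "y = z" by simp
    qed
    then show ?thesis unfolding B_def by (simp add: card_image card_cartesian_product)
  qed
  moreover have "card (\<Union>i<n. B i) = (\<Sum>i<n. card (B i))"
  proof (rule card_UN_disjoint)
    have "i = j" if "w \<in> B i" "w \<in> B j" for i j w
    proof -
      obtain s t where s: "w = One # (s @ t) @ [Zero]" "s \<in> settled_arches (Suc i)"
        using \<open>w \<in> B i\<close> by (auto simp: B_def)
      obtain s' t' where s': "w = One # (s' @ t') @ [Zero]" "s' \<in> settled_arches (Suc j)"
        using \<open>w \<in> B j\<close> by (auto simp: B_def)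
      have "s = s'" using s s' by (intro unique[of s t s' t']) auto
      then show ?thesis using s s' by (simp add: settled_arches_def)
    qed
    then show "\<forall>i\<in>{..<n}. \<forall>j\<in>{..<n}. i \<noteq> j \<longrightarrow> B i \<inter> B j = {}" by blast
  qed (simp_all add: B_def finite_settled_arches)
  moreover have "U \<inter> (\<Union>i<n. B i) = {}"
  proof -
    have False if "w \<in> U" "w \<in> B i" for w i
    proof -
      obtain s where s: "w = One # s @ [Zero]" "s \<in> settled_arches (Suc n)"
        using \<open>w \<in> U\<close> by (auto simp: U_def)
      obtain s' t' where s': "w = One # (s' @ t') @ [Zero]" "s' \<in> settled_arches (Suc i)"
          "t' \<in> settled_arches (n - i)"
        using \<open>w \<in> B i\<close> by (auto simp: B_def)
      \<comment> \<open>The unary form is read as a binary one with empty second part; then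
        \<open>t'\<close> would be empty, which no arch is.\<close>
      have "s = s'" using s s' by (intro unique[of s "[]" s' t']) auto
      then show False using s s' arches_nonempty by (auto simp: settled_arches_def)
    qed
    then show ?thesis by blast
  qed
  moreover have "settled_arches (Suc (Suc n)) = U \<union> (\<Union>i<n. B i)"
    unfolding U_def B_def by (rule settled_arches_rec)
  moreover have "finite U" "finite (\<Union>i<n. B i)"
    by (simp_all add: U_def B_def finite_settled_arches)
  ultimately show ?thesis by (simp add: card_Un_disjoint)
qed

lemma card_settled_arches: "card (settled_arches (Suc n)) = motz_rec n"
proof (induction n rule: less_induct)
  case (less n)
  consider "n = 0" | "n = Suc 0" | m where "n = Suc (Suc m)"
    by (metis not0_implies_Suc)
  then show ?case
  proof cases
    case (3 m)
    \<comment> \<open>For i \<le> m, \<open>Suc m - i\<close> is \<open>Suc (m - i)\<close>, so the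
      induction hypothesis applies to both factors.\<close>
    have "(\<Sum>i<Suc m. card (settled_arches (Suc i)) * card (settled_arches (Suc m - i))) =
        (\<Sum>i\<le>m. motz_rec i * motz_rec (m - i))"
      unfolding lessThan_Suc_atMost using less 3 by (intro sum.cong) (auto simp: Suc_diff_le)
    then show ?thesis using less[of "Suc m"] 3 card_settled_arches_rec[of "Suc m"] by simp
  qed (simp_all add: settled_arches_1 card_settled_arches_rec[of 0])
qed

lemma motzkin_eq_motz_rec: "motzkin n = motz_rec n"
proof -
  have "Abs_fps motz_rec = 1 + fps_X * Abs_fps motz_rec + fps_X\<^sup>2 * (Abs_fps motz_rec)\<^sup>2"
    unfolding motzkin_equation_iff by simp
  then have "Abs_fps motz_rec = motzkin_fps"
    using motzkin_fps_ex1 motzkin_fps_equation by blast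
  then show ?thesis unfolding motzkin_def by (metis fps_nth_Abs_fps)
qed

section \<open>From edges of the dexter graph to maximal elements\<close>

lemma movable_edge:
  assumes "p @ x @ b \<in> dyck_paths n" "movable p x b"
  shows "\<exists>v \<in> dyck_paths n. (p @ x @ b, v) \<in> dexter_graph n \<and> v \<noteq> p @ x @ b"
proof -
  have x: "x \<in> arches" and p: "p \<noteq> []" "last p = Zero"
    using assms(2) by (auto simp: movable_def is_subpath_iff_arch)
  \<comment> \<open>The whole final run of \<open>Zero\<close> is split off, since
    \<open>dexter_graph\<close> requires that \<open>a\<close> not end with
    \<open>Zero\<close>.\<close>
  define z where "z = takeWhile (\<lambda>l. l = Zero) (rev p)"
  define a where "a = rev (dropWhile (\<lambda>l. l = Zero) (rev p))"
  have z: "z = replicate (length z) Zero"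
    unfolding z_def by (metis (mono_tags, lifting) replicate_length_same set_takeWhileD)
  have "p = rev (rev p)" by simp
  also have "rev p = z @ dropWhile (\<lambda>l. l = Zero) (rev p)" by (simp add: z_def)
  finally have pz: "p = a @ replicate (length z) Zero"
    using z by (metis a_def rev_append rev_replicate)
  have a: "a = [] \<or> last a \<noteq> Zero"
    using hd_dropWhile[of "\<lambda>l. l = Zero" "rev p"] by (auto simp: a_def last_rev)
  have "length z \<noteq> 0" using pz p a by auto
  then obtain N where N: "length z = Suc N" by (metis not0_implies_Suc)
  define c where "c = a @ replicate N Zero"
  have pc: "p = c @ [Zero]" using pz N by (simp add: c_def replicate_append_same)
  \<comment> \<open>The move with i = 1. It lifts \<open>x\<close> by one level, which keeps the
    path nonnegative, and puts the first \<open>One\<close> of \<open>x\<close> where a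
    \<open>Zero\<close> stood, so the path changes.\<close>
  let ?v = "c @ x @ [Zero] @ b"
  have edge: "(p @ x @ b, ?v) \<in> dexter_graph n"
    unfolding dexter_graph_def mem_Collect_eq
    by (rule exI[of _ "p @ x @ b"], rule exI[of _ a], rule exI[of _ "Suc N"], rule exI[of _ x],
        rule exI[of _ b], rule exI[of _ 1])
      (use assms a pz N in \<open>auto simp: c_def\<close>)
  have "balanced (c @ [Zero] @ x @ b)" "length ?v = 2 * n"
    using assms(1) pc by (auto simp: dyck_paths_iff)
  then have "balanced ?v"
    using arch_balanced[OF x] stays_mono[of 0 x "height c"] stays_height[of 0 c]
    by (auto simp: balanced_def)
  then have "?v \<in> dyck_paths n" using \<open>length ?v = 2 * n\<close> by (simp add: dyck_paths_iff)
  moreover have "?v \<noteq> p @ x @ b" using x pc by (auto simp: arches_def)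
  ultimately show ?thesis using edge by blast
qed

text \<open>A movable subpath gives an edge to a different path, by \<open>movable_edge\<close>; a
  path without outgoing edges reaches only itself in the closure.\<close>

lemma dexter_maximal_iff: "u \<in> dexter_maximal n \<longleftrightarrow> u \<in> dyck_paths n \<and> settled u"
proof
  assume u: "u \<in> dexter_maximal n"
  have "settled u"
  proof (rule ccontr)
    assume "\<not> settled u"
    then obtain p x b where "u = p @ x @ b" "movable p x b" using not_settled_iff by blast
    then obtain v where "(u, v) \<in> dexter_graph n" "v \<in> dyck_paths n" "v \<noteq> u"
      using movable_edge[of p x b n] u by (auto simp: dexter_maximal_def)
    then show False using u by (auto simp: dexter_maximal_def dexter_le_def)
  qed
  then show "u \<in> dyck_paths n \<and> settled u" using u by (simp add: dexter_maximal_def)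
next
  assume u: "u \<in> dyck_paths n \<and> settled u"
  have "(u, v) \<notin> dexter_graph n" for v
  proof
    assume "(u, v) \<in> dexter_graph n"
    then obtain a N x b where "u = (a @ replicate N Zero) @ x @ b"
        "movable (a @ replicate N Zero) x b"
      by (auto simp: dexter_graph_def)
    then show False using u not_settled_iff by blast
  qed
  then have "v = u" if "(u, v) \<in> (dexter_graph n)\<^sup>*" for v
    using that by (metis converse_rtranclE)
  then show "u \<in> dexter_maximal n" using u by (auto simp: dexter_maximal_def dexter_le_def)
qed

lemma dexter_maximal_eq:
  assumes "n \<ge> 1"
  shows "dexter_maximal n = settled_arches n"
proof -
  \<comment> \<open>The bound on \<open>n\<close> excludes the empty word, which is balanced and
    settled but no arch.\<close>
  have "w \<in> arches" if "balanced w" "settled w" "length w = 2 * n" for w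
    by (rule settled_balanced_arch) (use that assms in auto)
  then show ?thesis
    using arch_balanced by (auto simp: dexter_maximal_iff settled_arches_def dyck_paths_iff)
qed

theorem proposition1p4:
  fixes n :: nat
  assumes "n \<ge> 1"
  shows "card (dexter_maximal n) = motzkin (n - 1)"
  using assms card_settled_arches[of "n - 1"] by (simp add: dexter_maximal_eq motzkin_eq_motz_rec)

end
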